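(* Let $F=\{f_i\}_{i=1}^N$ and $G=\{g_i\}_{i=1}^N$ be p.c.f. IFSs on complete metric spaces $(X,d_1)$ and $(Y,d_2)$ respectively, with attractors $K$ and $K'$ respectively. Suppose that (i) both $F$ and $G$ satisfy the single intersection condition (SIC) and the angle separation condition (ASC); (ii) $F$ and $G$ have the same topology automaton. Then $(K,d_1)$ and $(K',d_2)$ are Hölder equivalent.
   Context: An iterated function system (IFS) $F=\{f_i\}_{i=1}^N$ is a finite family of contractions on a complete metric space $(X,d)$; all maps in an IFS are assumed bi-Lipschitz, i.e. there are $0<A_i\le B_i<\infty$ with $A_i d(x,y)\le d(f_i(x),f_i(y))\le B_i d(x,y)$. Its attractor is the unique nonempty compact $K$ with $K=\bigcup_{i=1}^N f_i(K)$. Put $\Sigma=\{1,\dots,N\}$, $\Sigma^*=\bigcup_{k\ge1}\Sigma^k$, $f_{\omega_1\cdots\omega_k}=f_{\omega_1}\circ\cdots\circ f_{\omega_k}$. The coding map $\pi_K:\Sigma^\infty\to K$ is defined by $\{\pi_K(i_1i_2\cdots)\}=\bigcap_{k\ge1}f_{i_1\cdots i_k}(K)$. The critical set is $C_F=\bigcup_{i\ne j}f_i(K)\cap f_j(K)$ and the post-critical set is $P_F=\bigcup_{\omega\in\Sigma^*}\big(f_\omega^{-1}(C_F)\cap K\big)$. $F$ is post-critically finite (p.c.f.) if $\pi_K^{-1}(P_F)$ is finite. SIC: for all $i\ne j$, $f_i(K)\cap f_j(K)$ contains at most one point. ASC (for an IFS satisfying the SIC): there is $c>0$ such that whenever $i\neq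 j$ and $f_i(K)\cap f_j(K)=\{z\}$, one has $d(x,y)\ge c\max\{d(x,z),d(y,z)\}$ for all $x\in f_i(K)$, $y\in f_j(K)$. Topology automaton $M_F$ of a p.c.f. IFS $F$ with SIC, with $P=P_F$: the state set is $\{S_{uv}: u,v\in P\}\cup\{Id,Exit\}$ ($u=v$ allowed), the input alphabet is $\Sigma^2$, the initial state is $Id$, the final state is $Exit$, and the transition function $\delta$ is: - $\delta(Id,(i,j))=Id$ if $i=j$; $=S_{uv}$ if $i\ne j$, $f_i(K)\cap f_j(K)\ne\emptyset$ and $(u,v)\in P^2$ is the unique pair with $f_i(v)=f_j(u)$; $=Exit$ if $i\neq j$ and $f_i(K)\cap f_j(K)=\emptyset$. - $\delta(S_{u_1v_1},(i,j))=S_{u_2v_2}$ if $(u_2,v_2)\in P^2$ is the (unique) pair with $f_i(v_2)=v_1$ and $f_j(u_2)=u_1$; $=Exit$ otherwise (that is, if $v_1\notin f_i(K)$ or $u_1\notin f_j(K)$). $F$ and $G$ have the same topology automaton if there is a bijection $\beta:P_F\to P_G$ such that, after the relabeling $S_{uv}\mapsto S_{\beta(u)\beta(v)}$, $Id\mapsto Id$, $Exit\mapsto Exit$, the transition function of $M_F$ becomes that of $M_G$. Hölder equivalent: there are a bijection $h:K\to K'$ and constants $C,s>0$ with $C^{-1}d_1(x,y)^{1/s}\le d_2(h(x),h(y))\le C d_1(x,y)^s$ for all $x,y\in K$. *)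

theory Defs
  imports "HOL-Analysis.Analysis"
begin

text \<open>
  An iterated function system is a family \<open>f\<close> of self-maps of a complete metric space, of which only
  the members with index in \<open>{1..N}\<close> matter.
\<close>

definition contraction :: "('a::metric_space \<Rightarrow> 'a) \<Rightarrow> bool" where
  "contraction g \<longleftrightarrow> (\<exists>c. 0 \<le> c \<and> c < 1 \<and> (\<forall>x y. dist (g x) (g y) \<le> c * dist x y))"

definition bi_Lipschitz :: "('a::metric_space \<Rightarrow> 'a) \<Rightarrow> bool" where
  "bi_Lipschitz g \<longleftrightarrow> (\<exists>A B. 0 < A \<and> A \<le> B \<and>
     (\<forall>x y. A * dist x y \<le> dist (g x) (g y) \<and> dist (g x) (g y) \<le> B * dist x y))"

definition IFS :: "nat \<Rightarrow> (nat \<Rightarrow> 'a::complete_space \<Rightarrow> 'a) \<Rightarrow> bool" where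
  "IFS N f \<longleftrightarrow> (\<forall>i\<in>{1..N}. contraction (f i) \<and> bi_Lipschitz (f i))"

text \<open>
  For an \<open>IFS\<close> with \<open>N \<ge> 1\<close> there is exactly one such \<open>K\<close>, by Hutchinson's theorem; for \<open>N = 0\<close>
  there is none. Later definitions take the attractor \<open>K\<close> as a parameter.
\<close>

definition is_attractor :: "nat \<Rightarrow> (nat \<Rightarrow> 'a::complete_space \<Rightarrow> 'a) \<Rightarrow> 'a set \<Rightarrow> bool" where
  "is_attractor N f K \<longleftrightarrow> K \<noteq> {} \<and> compact K \<and> K = (\<Union>i\<in>{1..N}. f i ` K)"

text \<open>\<open>word_map f [i\<^sub>1, \<dots>, i\<^sub>k] = f i\<^sub>1 \<circ> \<dots> \<circ> f i\<^sub>k\<close>\<close>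

definition word_map :: "(nat \<Rightarrow> 'a \<Rightarrow> 'a) \<Rightarrow> nat list \<Rightarrow> 'a \<Rightarrow> 'a" where
  "word_map f w = foldr (\<lambda>i g. f i \<circ> g) w id"

definition words :: "nat \<Rightarrow> nat list set" where
  "words N = {w. w \<noteq> [] \<and> set w \<subseteq> {1..N}}"

definition inf_words :: "nat \<Rightarrow> (nat \<Rightarrow> nat) set" where
  "inf_words N = {\<omega>. \<forall>n. \<omega> n \<in> {1..N}}"

text \<open>Infinite words are indexed from \<open>0\<close>, so the prefix of length \<open>k\<close> is \<open>map \<omega> [0..<k]\<close>.\<close>

definition coding_map :: "(nat \<Rightarrow> 'a \<Rightarrow> 'a) \<Rightarrow> 'a set \<Rightarrow> (nat \<Rightarrow> nat) \<Rightarrow> 'a" where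
  "coding_map f K \<omega> = (THE x. {x} = (\<Inter>k\<in>{1..}. word_map f (map \<omega> [0..<k]) ` K))"

definition critical_set :: "nat \<Rightarrow> (nat \<Rightarrow> 'a \<Rightarrow> 'a) \<Rightarrow> 'a set \<Rightarrow> 'a set" where
  "critical_set N f K = (\<Union>i\<in>{1..N}. \<Union>j\<in>{1..N} - {i}. f i ` K \<inter> f j ` K)"

definition post_critical_set :: "nat \<Rightarrow> (nat \<Rightarrow> 'a \<Rightarrow> 'a) \<Rightarrow> 'a set \<Rightarrow> 'a set" where
  "post_critical_set N f K = (\<Union>w\<in>words N. word_map f w -` critical_set N f K \<inter> K)"

definition pcf :: "nat \<Rightarrow> (nat \<Rightarrow> 'a \<Rightarrow> 'a) \<Rightarrow> 'a set \<Rightarrow> bool" where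
  "pcf N f K \<longleftrightarrow> finite {\<omega> \<in> inf_words N. coding_map f K \<omega> \<in> post_critical_set N f K}"

definition SIC :: "nat \<Rightarrow> (nat \<Rightarrow> 'a \<Rightarrow> 'a) \<Rightarrow> 'a set \<Rightarrow> bool" where
  "SIC N f K \<longleftrightarrow> (\<forall>i\<in>{1..N}. \<forall>j\<in>{1..N}. i \<noteq> j \<longrightarrow>
     (\<forall>x\<in>f i ` K \<inter> f j ` K. \<forall>y\<in>f i ` K \<inter> f j ` K. x = y))"

definition ASC :: "nat \<Rightarrow> (nat \<Rightarrow> 'a::metric_space \<Rightarrow> 'a) \<Rightarrow> 'a set \<Rightarrow> bool" where
  "ASC N f K \<longleftrightarrow> (\<exists>c>0. \<forall>i\<in>{1..N}. \<forall>j\<in>{1..N}. \<forall>z. i \<noteq> j \<and> f i ` K \<inter> f j ` K = {z} \<longrightarrow>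
     (\<forall>x\<in>f i ` K. \<forall>y\<in>f j ` K. dist x y \<ge> c * max (dist x z) (dist y z)))"

text \<open>
  The states of the topology automaton. The initial state is called \<open>Init\<close> rather than \<open>Id\<close>, which
  is the identity relation in HOL; \<open>S u v\<close> is \<open>S\<^bsub>uv\<^esub>\<close>.
\<close>

datatype 'p state = Init | Exit | S 'p 'p

definition automaton_states :: "'p set \<Rightarrow> 'p state set" where
  "automaton_states P = {S u v |u v. u \<in> P \<and> v \<in> P} \<union> {Init, Exit}"

text \<open>
  Under the SIC and injectivity of the maps, the pairs selected by \<open>THE\<close> exist and are unique. The
  value at the final state \<open>Exit\<close>, which has no transitions of its own, is a convention; it is
  preserved by every relabeling.
\<close>

fun automaton_trans ::
  "(nat \<Rightarrow> 'a \<Rightarrow> 'a) \<Rightarrow> 'a set \<Rightarrow> 'a set \<Rightarrow> 'a state \<Rightarrow> nat \<times> nat \<Rightarrow> 'a state" where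
  "automaton_trans f K P Init (i, j) =
     (if i = j then Init
      else if f i ` K \<inter> f j ` K \<noteq> {}
        then (case (THE (u, v). u \<in> P \<and> v \<in> P \<and> f i v = f j u) of (u, v) \<Rightarrow> S u v)
      else Exit)"
| "automaton_trans f K P (S u1 v1) (i, j) =
     (if \<exists>u2\<in>P. \<exists>v2\<in>P. f i v2 = v1 \<and> f j u2 = u1
        then (case (THE (u2, v2). u2 \<in> P \<and> v2 \<in> P \<and> f i v2 = v1 \<and> f j u2 = u1) of
                (u2, v2) \<Rightarrow> S u2 v2)
      else Exit)"
| "automaton_trans f K P Exit (i, j) = Exit"

text \<open>\<open>map_state \<beta>\<close> is the relabeling of states induced by \<open>\<beta>\<close>.\<close>

definition same_topology_automaton ::
  "nat \<Rightarrow> (nat \<Rightarrow> 'a \<Rightarrow> 'a) \<Rightarrow> 'a set \<Rightarrow> (nat \<Rightarrow> 'b \<Rightarrow> 'b) \<Rightarrow> 'b set \<Rightarrow> bool" where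
  "same_topology_automaton N f K g K' \<longleftrightarrow>
     (let P = post_critical_set N f K; P' = post_critical_set N g K' in
       \<exists>\<beta>. bij_betw \<beta> P P' \<and>
         (\<forall>q\<in>automaton_states P. \<forall>a\<in>{1..N} \<times> {1..N}.
            automaton_trans g K' P' (map_state \<beta> q) a
              = map_state \<beta> (automaton_trans f K P q a)))"

definition Holder_equivalent :: "'a::metric_space set \<Rightarrow> 'b::metric_space set \<Rightarrow> bool" where
  "Holder_equivalent K K' \<longleftrightarrow> (\<exists>h C s. bij_betw h K K' \<and> C > 0 \<and> s > 0 \<and>
     (\<forall>x\<in>K. \<forall>y\<in>K. inverse C * dist x y powr (1 / s) \<le> dist (h x) (h y) \<and>
        dist (h x) (h y) \<le> C * dist x y powr s))"

end

theory Submission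
  imports Defs
begin

text \<open>
  Feed two codes \<open>\<omega>\<close>, \<open>\<tau>\<close> into the automaton and compare the time at which it exits with
  the distance of the coded points. As long as the automaton has not exited after \<open>n\<close> steps, the two
  cylinders of level \<open>n\<close> meet, so the distance is at most a constant times \<open>r ^ n\<close>. If it
  exits at step \<open>n\<close>, then either two disjoint pieces are separated by a definite amount, or one of
  the finitely many post-critical points is at a definite distance from a piece not containing it; in the
  latter case the angle separation condition turns the distance to the common point of the cylinders into
  the distance of the two points. Either way the distance is at least a constant times \<open>a ^ n\<close>.
  Isomorphic automata have the same exit times, so sending the point of \<open>K\<close> with code \<open>\<omega>\<close>
  to the point of \<open>K'\<close> with code \<open>\<omega>\<close> is a well-defined bi-Hoelder bijection.
\<close>

section \<open>Uniform constants, separation of sets, geometric decay\<close>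

lemma finite_uniform_pos:
  fixes Q :: "'i \<Rightarrow> real \<Rightarrow> bool"
  assumes "finite I" and "\<And>i. i \<in> I \<Longrightarrow> \<exists>d>0. Q i d"
    and "\<And>i d e. i \<in> I \<Longrightarrow> Q i d \<Longrightarrow> 0 < e \<Longrightarrow> e \<le> d \<Longrightarrow> Q i e"
  shows "\<exists>d>0. \<forall>i\<in>I. Q i d"
proof -
  obtain d where d: "\<And>i. i \<in> I \<Longrightarrow> d i > 0 \<and> Q i (d i)"
    using assms(2) by metis
  \<comment> \<open>The extra element 1 makes the minimum meaningful and positive even when
    \<open>I\<close> is empty.\<close>
  let ?m = "Min (insert 1 (d ` I))"
  have pos: "?m > 0"
    using assms(1) d by (subst Min_gr_iff) auto
  have "?m \<le> d i" if "i \<in> I" for i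
    using assms(1) that by (intro Min_le) auto
  then show ?thesis
    using pos d assms(3) by blast
qed

text \<open>The function \<open>infdist\<close> to \<open>T\<close> is continuous and attains its
  minimum on the compact set \<open>S\<close>; since \<open>T\<close> is closed, the minimum is
  positive. The argument works in every metric space, without the Heine-Borel property.\<close>

lemma separate_compact_closed_metric:
  fixes S T :: "'a::metric_space set"
  assumes "compact S" "closed T" "S \<inter> T = {}"
  shows "\<exists>d>0. \<forall>x\<in>S. \<forall>y\<in>T. d \<le> dist x y"
proof (cases "S = {} \<or> T = {}")
  case True
  then show ?thesis
    using zero_less_one by blast
next
  case False
  have "continuous_on S (\<lambda>x. infdist x T)"
    by (intro continuous_intros)
  then obtain x where x: "x \<in> S" "\<And>y. y \<in> S \<Longrightarrow> infdist x T \<le> infdist y T"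
    using continuous_attains_inf[OF assms(1)] False by metis
  have "infdist x T > 0"
    using infdist_pos_not_in_closed x(1) False assms by blast
  moreover have "infdist x T \<le> dist y z" if "y \<in> S" "z \<in> T" for y z
    using x(2) infdist_le that by (metis order_trans)
  ultimately show ?thesis by blast
qed

lemma le_geometric_imp_le_0:
  fixes d C r :: real
  assumes "\<And>n. d \<le> C * r ^ n" "0 < r" "r < 1"
  shows "d \<le> 0"
proof (rule LIMSEQ_le_const)
  show "(\<lambda>n. C * r ^ n) \<longlonglongrightarrow> 0"
    using assms(2,3) by (auto intro!: tendsto_mult_right_zero LIMSEQ_realpow_zero)
qed (use assms(1) in auto)

section \<open>Finite words and runs of the automaton\<close>

abbreviation prefix :: "(nat \<Rightarrow> nat) \<Rightarrow> nat \<Rightarrow> nat list" where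
  "prefix \<omega> n \<equiv> map \<omega> [0..<n]"

lemma word_map_Nil [simp]: "word_map f [] = id"
  by (simp add: word_map_def)

lemma word_map_Cons [simp]: "word_map f (i # w) x = f i (word_map f w x)"
  by (simp add: word_map_def)

lemma word_map_append [simp]: "word_map f (u @ w) x = word_map f u (word_map f w x)"
  by (induction u) auto

text \<open>The state after \<open>n\<close> steps has read the letter pairs with indices below
  \<open>n\<close>, so it matches the cylinders given by the prefixes of length \<open>n\<close>.
  The convention at \<open>Exit\<close> makes exiting permanent.\<close>

primrec run :: "(nat \<Rightarrow> 'a \<Rightarrow> 'a) \<Rightarrow> 'a set \<Rightarrow> 'a set \<Rightarrow> (nat \<Rightarrow> nat) \<Rightarrow> (nat \<Rightarrow> nat) \<Rightarrow> nat \<Rightarrow> 'a state"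
  where
    "run f K P \<omega> \<tau> 0 = Init"
  | "run f K P \<omega> \<tau> (Suc n) = automaton_trans f K P (run f K P \<omega> \<tau> n) (\<omega> n, \<tau> n)"

section \<open>Cylinders of the attractor\<close>

locale attractor_IFS =
  fixes N :: nat and f :: "nat \<Rightarrow> 'a::complete_space \<Rightarrow> 'a" and K :: "'a set"
  assumes ifs: "IFS N f" and attractor: "is_attractor N f K"
begin

abbreviation "P \<equiv> post_critical_set N f K"

abbreviation "\<pi> \<equiv> coding_map f K"

lemma compact_K: "compact K" and K_nonempty: "K \<noteq> {}"
  and K_eq: "K = (\<Union>i\<in>{1..N}. f i ` K)"
  using attractor unfolding is_attractor_def by blast+

lemma f_in_K: "i \<in> {1..N} \<Longrightarrow> x \<in> K \<Longrightarrow> f i x \<in> K"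
  using K_eq by blast

lemma ratio_bounds:
  obtains a r where "0 < a" "a < 1" "0 < r" "r < 1"
    "\<And>i x y. i \<in> {1..N} \<Longrightarrow> a * dist x y \<le> dist (f i x) (f i y)"
    "\<And>i x y. i \<in> {1..N} \<Longrightarrow> dist (f i x) (f i y) \<le> r * dist x y"
proof -
  have "\<exists>a>0. \<forall>i\<in>{1..N}. \<forall>x y. a * dist x y \<le> dist (f i x) (f i y)"
  proof (rule finite_uniform_pos)
    show "\<exists>a>0. \<forall>x y. a * dist x y \<le> dist (f i x) (f i y)" if "i \<in> {1..N}" for i
      using that ifs unfolding IFS_def bi_Lipschitz_def by metis
  next
    fix i d e
    assume "\<forall>x y. d * dist x y \<le> dist (f i x) (f i y)" "0 < e" "e \<le> d"
    then show "\<forall>x y. e * dist x y \<le> dist (f i x) (f i y)"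
      by (meson mult_right_mono order_trans zero_le_dist)
  qed auto
  then obtain a where a: "a > 0" "\<And>i x y. i \<in> {1..N} \<Longrightarrow> a * dist x y \<le> dist (f i x) (f i y)"
    by blast
  \<comment> \<open>Writing the contraction ratio as \<open>1 - d\<close> turns a common upper bound
    on the ratios into a common positive \<open>d\<close>, which may be shrunk freely.\<close>
  have "\<exists>d>0. \<forall>i\<in>{1..N}. \<forall>x y. dist (f i x) (f i y) \<le> (1 - d) * dist x y"
  proof (rule finite_uniform_pos)
    fix i assume "i \<in> {1..N}"
    then obtain c where "c < 1" "\<forall>x y. dist (f i x) (f i y) \<le> c * dist x y"
      using ifs unfolding IFS_def contraction_def by blast
    then show "\<exists>d>0. \<forall>x y. dist (f i x) (f i y) \<le> (1 - d) * dist x y"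
      by (intro exI[of _ "1 - c"]) auto
  next
    fix i d e :: real
    show "\<forall>x y. dist (f i x) (f i y) \<le> (1 - e) * dist x y"
      if "\<forall>x y. dist (f i x) (f i y) \<le> (1 - d) * dist x y" "0 < e" "e \<le> d" for i d e
      using that by (smt (verit) mult_right_mono zero_le_dist)
  qed auto
  then obtain d where d: "d > 0"
    "\<And>i x y. i \<in> {1..N} \<Longrightarrow> dist (f i x) (f i y) \<le> (1 - d) * dist x y"
    by blast
  show ?thesis
  \<comment> \<open>The cutoffs at 1/2 force both ratios strictly between 0 and 1, so that their
    logarithms are negative later on.\<close>
  proof (rule that[of "min a (1/2)" "max (1 - d) (1/2)"])
    show "min a (1/2) * dist x y \<le> dist (f i x) (f i y)" if "i \<in> {1..N}" for i x y
      by (rule order_trans[OF mult_right_mono a(2)[OF that]]) auto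
    show "dist (f i x) (f i y) \<le> max (1 - d) (1/2) * dist x y" if "i \<in> {1..N}" for i x y
      by (rule order_trans[OF d(2)[OF that] mult_right_mono]) auto
  qed (use a(1) d(1) in auto)
qed

lemma f_inj: "i \<in> {1..N} \<Longrightarrow> f i x = f i y \<longleftrightarrow> x = y"
proof -
  assume i: "i \<in> {1..N}"
  obtain a where "0 < a" "a * dist x y \<le> dist (f i x) (f i y)"
    using ratio_bounds i by metis
  then show ?thesis
    by (metis dist_eq_0_iff mult_pos_pos not_le zero_less_dist_iff)
qed

lemma word_map_lower:
  assumes "\<And>i x y. i \<in> {1..N} \<Longrightarrow> a * dist x y \<le> dist (f i x) (f i y)" "0 < a"
    and "set w \<subseteq> {1..N}"
  shows "a ^ length w * dist x y \<le> dist (word_map f w x) (word_map f w y)"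
  using assms(3)
proof (induction w)
  case (Cons i w)
  have "a ^ length (i # w) * dist x y \<le> a * dist (word_map f w x) (word_map f w y)"
    using Cons assms(2) by (simp add: mult.assoc)
  also have "\<dots> \<le> dist (word_map f (i # w) x) (word_map f (i # w) y)"
    using Cons.prems assms(1) by simp
  finally show ?case .
qed simp

lemma word_map_upper:
  assumes "\<And>i x y. i \<in> {1..N} \<Longrightarrow> dist (f i x) (f i y) \<le> r * dist x y" "0 < r"
    and "set w \<subseteq> {1..N}"
  shows "dist (word_map f w x) (word_map f w y) \<le> r ^ length w * dist x y"
  using assms(3)
proof (induction w)
  case (Cons i w)
  have "dist (word_map f (i # w) x) (word_map f (i # w) y)
      \<le> r * dist (word_map f w x) (word_map f w y)"
    using Cons.prems assms(1) by simp
  also have "\<dots> \<le> r ^ length (i # w) * dist x y"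
    using Cons assms(2) by (simp add: mult.assoc)
  finally show ?case .
qed simp

lemma set_prefix: "\<omega> \<in> inf_words N \<Longrightarrow> set (prefix \<omega> n) \<subseteq> {1..N}"
  by (auto simp: inf_words_def)

lemma compact_cylinder: "set w \<subseteq> {1..N} \<Longrightarrow> compact (word_map f w ` K)"
proof -
  assume w: "set w \<subseteq> {1..N}"
  obtain r where r: "0 < r" "\<And>i x y. i \<in> {1..N} \<Longrightarrow> dist (f i x) (f i y) \<le> r * dist x y"
    using ratio_bounds by metis
  have "(r ^ length w)-lipschitz_on K (word_map f w)"
    using word_map_upper[OF r(2) r(1) w] r(1) by (auto intro!: lipschitz_onI)
  then show ?thesis
    by (metis lipschitz_on_continuous_on compact_continuous_image compact_K)
qed

lemma compact_image: "i \<in> {1..N} \<Longrightarrow> compact (f i ` K)"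
  using compact_cylinder[of "[i]"] by simp

lemma cylinder_Suc_subset:
  assumes "\<omega> \<in> inf_words N"
  shows "word_map f (prefix \<omega> (Suc n)) ` K \<subseteq> word_map f (prefix \<omega> n) ` K"
  using assms f_in_K by (auto simp: inf_words_def)

lemma K_diameter: obtains D where "D > 0" "\<And>x y. x \<in> K \<Longrightarrow> y \<in> K \<Longrightarrow> dist x y \<le> D"
proof -
  obtain e where "\<And>x y. x \<in> K \<Longrightarrow> y \<in> K \<Longrightarrow> dist x y \<le> e"
    using compact_imp_bounded[OF compact_K] bounded_two_points by metis
  then show ?thesis
    using that[of "max e 1"] by (meson less_max_iff_disj max.coboundedI1 zero_less_one)
qed

lemma cylinder_diameter:
  obtains D r where "D > 0" "0 < r" "r < 1"
    "\<And>\<omega> n x y. \<omega> \<in> inf_words N \<Longrightarrow> x \<in> word_map f (prefix \<omega> n) ` K \<Longrightarrow>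
      y \<in> word_map f (prefix \<omega> n) ` K \<Longrightarrow> dist x y \<le> D * r ^ n"
proof -
  obtain r where r: "0 < r" "r < 1"
    "\<And>i x y. i \<in> {1..N} \<Longrightarrow> dist (f i x) (f i y) \<le> r * dist x y"
    using ratio_bounds by metis
  obtain D where D: "D > 0" "\<And>x y. x \<in> K \<Longrightarrow> y \<in> K \<Longrightarrow> dist x y \<le> D"
    using K_diameter by blast
  show ?thesis
  proof (rule that[OF D(1) r(1,2)])
    fix \<omega> n x y
    assume \<omega>: "\<omega> \<in> inf_words N"
      and "x \<in> word_map f (prefix \<omega> n) ` K" "y \<in> word_map f (prefix \<omega> n) ` K"
    then obtain x' y' where xy: "x' \<in> K" "y' \<in> K"
      "x = word_map f (prefix \<omega> n) x'" "y = word_map f (prefix \<omega> n) y'"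
      by blast
    then have "dist x y \<le> r ^ n * dist x' y'"
      using word_map_upper[OF r(3,1) set_prefix[OF \<omega>], of n x' y'] by simp
    also have "\<dots> \<le> r ^ n * D"
      using D(2) xy r(1) by (intro mult_left_mono) auto
    finally show "dist x y \<le> D * r ^ n"
      by (simp add: mult.commute)
  qed
qed

section \<open>The coding map\<close>

lemma cylinders_singleton:
  assumes \<omega>: "\<omega> \<in> inf_words N"
  shows "\<exists>x. (\<Inter>n. word_map f (prefix \<omega> n) ` K) = {x}"
proof (rule decreasing_closed_nest_sing)
  show "closed (word_map f (prefix \<omega> n) ` K)" for n
    using compact_cylinder[OF set_prefix[OF \<omega>]] compact_imp_closed by blast
  show "word_map f (prefix \<omega> n) ` K \<noteq> {}" for n
    using K_nonempty by blast
  show "word_map f (prefix \<omega> n) ` K \<subseteq> word_map f (prefix \<omega> m) ` K" if "m \<le> n" for m n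
    by (rule lift_Suc_antimono_le[of "\<lambda>n. word_map f (prefix \<omega> n) ` K"])
      (use cylinder_Suc_subset[OF \<omega>] that in auto)
  fix \<epsilon> :: real assume "\<epsilon> > 0"
  obtain D r where D: "D > 0" "r < 1"
    "\<And>n x y. x \<in> word_map f (prefix \<omega> n) ` K \<Longrightarrow>
      y \<in> word_map f (prefix \<omega> n) ` K \<Longrightarrow> dist x y \<le> D * r ^ n"
    using cylinder_diameter \<omega> by metis
  obtain n where "r ^ n < \<epsilon> / D"
    using real_arch_pow_inv[of "\<epsilon> / D" r] \<open>\<epsilon> > 0\<close> D by auto
  then have "D * r ^ n < \<epsilon>"
    using D(1) by (simp add: field_simps)
  then show "\<exists>n. \<forall>x\<in>word_map f (prefix \<omega> n) ` K. \<forall>y\<in>word_map f (prefix \<omega> n) ` K. dist x y < \<epsilon>"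
    using D(3) by (meson le_less_trans)
qed

lemma coding_map_singleton:
  assumes \<omega>: "\<omega> \<in> inf_words N"
  shows "(\<Inter>n. word_map f (prefix \<omega> n) ` K) = {\<pi> \<omega>}"
proof -
  obtain x where x: "(\<Inter>n. word_map f (prefix \<omega> n) ` K) = {x}"
    using cylinders_singleton[OF \<omega>] by blast
  \<comment> \<open>The definition of the coding map starts at level 1; by nestedness, level 0
    changes nothing.\<close>
  have eq: "(\<Inter>n. word_map f (prefix \<omega> n) ` K) = (\<Inter>k\<in>{1..}. word_map f (prefix \<omega> k) ` K)"
  proof (intro equalityI INT_greatest)
    fix n
    show "(\<Inter>k\<in>{1..}. word_map f (prefix \<omega> k) ` K) \<subseteq> word_map f (prefix \<omega> n) ` K"
    proof
      fix x assume "x \<in> (\<Inter>k\<in>{1..}. word_map f (prefix \<omega> k) ` K)"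
      then have "x \<in> word_map f (prefix \<omega> (Suc n)) ` K"
        by (rule INT_D) simp
      then show "x \<in> word_map f (prefix \<omega> n) ` K"
        using cylinder_Suc_subset[OF \<omega>] by blast
    qed
  qed blast
  show ?thesis
    unfolding coding_map_def eq[symmetric] x by simp
qed

lemma coding_map_in_cylinder:
  assumes "\<omega> \<in> inf_words N"
  shows "\<pi> \<omega> \<in> word_map f (prefix \<omega> n) ` K"
proof -
  have "\<pi> \<omega> \<in> (\<Inter>n. word_map f (prefix \<omega> n) ` K)"
    using coding_map_singleton[OF assms] by (rule ssubst) simp
  then show ?thesis
    by (rule INT_D) simp
qed

lemma coding_map_eqI:
  assumes "\<omega> \<in> inf_words N" and "\<And>n. x \<in> word_map f (prefix \<omega> n) ` K"
  shows "\<pi> \<omega> = x"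
proof -
  have "x \<in> (\<Inter>n. word_map f (prefix \<omega> n) ` K)"
    using assms(2) by (rule INT_I)
  then show ?thesis
    unfolding coding_map_singleton[OF assms(1)] by simp
qed

lemma coding_map_in_K: "\<omega> \<in> inf_words N \<Longrightarrow> \<pi> \<omega> \<in> K"
  using coding_map_in_cylinder[of \<omega> 0] by simp

text \<open>Every point of \<open>K\<close> lies in some first-level piece. Choosing such a piece
  and pulling back, again and again, yields an orbit in \<open>K\<close> whose piece indices form a
  code of \<open>x\<close>.\<close>

lemma coding_map_surj:
  assumes x: "x \<in> K"
  obtains \<omega> where "\<omega> \<in> inf_words N" "\<pi> \<omega> = x"
proof -
  have "\<exists>i z. i \<in> {1..N} \<and> z \<in> K \<and> y = f i z" if "y \<in> K" for y
    using that K_eq by blast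
  then obtain ix pre where
    pre: "\<And>y. y \<in> K \<Longrightarrow> ix y \<in> {1..N} \<and> pre y \<in> K \<and> y = f (ix y) (pre y)"
    by metis
  define y where "y n = (pre ^^ n) x" for n
  have y: "y n \<in> K" for n
    by (induction n) (use x pre in \<open>auto simp: y_def\<close>)
  define \<omega> where "\<omega> n = ix (y n)" for n
  have \<omega>: "\<omega> \<in> inf_words N"
    using y pre unfolding \<omega>_def inf_words_def by blast
  have "x = word_map f (prefix \<omega> n) (y n)" for n
  proof (induction n)
    case (Suc n)
    have "y n = f (\<omega> n) (y (Suc n))"
      using pre[OF y[of n]] by (simp add: \<omega>_def y_def)
    then show ?case using Suc by simp
  qed (simp add: y_def)
  then have "x \<in> word_map f (prefix \<omega> n) ` K" for n
    using y by blast
  then have "\<pi> \<omega> = x"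
    by (rule coding_map_eqI[OF \<omega>])
  then show ?thesis
    using that \<omega> by blast
qed

section \<open>The post-critical set\<close>

lemma P_subset_K: "P \<subseteq> K"
  unfolding post_critical_set_def by blast

text \<open>Post-critical finiteness counts codes; every point has at least one code, so there are
  no more points than codes.\<close>

lemma pcf_imp_finite:
  assumes "pcf N f K"
  shows "finite P"
proof (rule finite_subset)
  show "finite (\<pi> ` {\<omega> \<in> inf_words N. \<pi> \<omega> \<in> P})"
    using assms unfolding pcf_def by (rule finite_imageI)
  show "P \<subseteq> \<pi> ` {\<omega> \<in> inf_words N. \<pi> \<omega> \<in> P}"
  proof
    fix x assume x: "x \<in> P"
    then obtain \<omega> where "\<omega> \<in> inf_words N" "\<pi> \<omega> = x"
      using P_subset_K coding_map_surj by blast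
    with x show "x \<in> \<pi> ` {\<omega> \<in> inf_words N. \<pi> \<omega> \<in> P}"
      by blast
  qed
qed

text \<open>A word that carries \<open>f i v\<close> into the critical set carries \<open>v\<close>
  there once \<open>i\<close> is appended. Hence the pullbacks made by the automaton never leave
  \<open>P\<close>.\<close>

lemma P_backward:
  assumes i: "i \<in> {1..N}" and "f i v \<in> P" "v \<in> K"
  shows "v \<in> P"
proof -
  obtain w where w: "w \<in> words N" "word_map f w (f i v) \<in> critical_set N f K"
    using assms(2) unfolding post_critical_set_def by blast
  then have "w @ [i] \<in> words N" "word_map f (w @ [i]) v \<in> critical_set N f K"
    using i by (auto simp: words_def)
  then show ?thesis
    using assms(3) unfolding post_critical_set_def by blast
qed

lemma critical_imp_P:
  assumes i: "i \<in> {1..N}" and "f i v \<in> critical_set N f K" "v \<in> K"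
  shows "v \<in> P"
proof -
  have "[i] \<in> words N" "word_map f [i] v \<in> critical_set N f K"
    using assms by (auto simp: words_def)
  then show ?thesis
    using assms(3) unfolding post_critical_set_def by blast
qed

section \<open>Transitions and the geometric meaning of states\<close>

lemma trans_S_Exit:
  assumes i: "i \<in> {1..N}" "j \<in> {1..N}" and uv: "u \<in> P" "v \<in> P"
    and "automaton_trans f K P (S u v) (i, j) = Exit"
  shows "v \<notin> f i ` K \<or> u \<notin> f j ` K"
proof (rule ccontr)
  assume "\<not> ?thesis"
  then obtain v2 u2 where "v2 \<in> K" "v = f i v2" "u2 \<in> K" "u = f j u2"
    by blast
  \<comment> \<open>The automaton looks for preimages in \<open>P\<close> only; those in
    \<open>K\<close> are in \<open>P\<close> automatically, so exiting really means that a point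
    misses a piece.\<close>
  moreover from this have "v2 \<in> P" "u2 \<in> P"
    using P_backward i uv by blast+
  ultimately show False
    using assms(5) by (auto split: prod.splits if_splits)
qed

lemma trans_S_not_Exit:
  assumes i: "i \<in> {1..N}" "j \<in> {1..N}"
    and "automaton_trans f K P (S u v) (i, j) \<noteq> Exit"
  obtains u2 v2 where "u2 \<in> P" "v2 \<in> P" "f i v2 = v" "f j u2 = u"
    "automaton_trans f K P (S u v) (i, j) = S u2 v2"
proof -
  obtain u2 v2 where 2: "u2 \<in> P" "v2 \<in> P" "f i v2 = v" "f j u2 = u"
    using assms(3) by (auto split: if_splits)
  have "(THE (u2, v2). u2 \<in> P \<and> v2 \<in> P \<and> f i v2 = v \<and> f j u2 = u) = (u2, v2)"
    by (rule the_equality) (use 2 f_inj i in auto)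
  then have "automaton_trans f K P (S u v) (i, j) = S u2 v2"
    using 2 by auto
  then show ?thesis
    using that 2 by blast
qed

text \<open>The common point of the two pieces is critical, so its preimages are post-critical. By
  the SIC it is the only common point, and injectivity then makes the pair selected by
  \<open>THE\<close> unique.\<close>

lemma trans_Init:
  assumes i: "i \<in> {1..N}" "j \<in> {1..N}" "i \<noteq> j" and sic: "SIC N f K"
    and ne: "f i ` K \<inter> f j ` K \<noteq> {}"
  obtains u v where "u \<in> P" "v \<in> P" "f i v = f j u" "f i ` K \<inter> f j ` K = {f i v}"
    "automaton_trans f K P Init (i, j) = S u v"
proof -
  obtain z where z: "f i ` K \<inter> f j ` K = {z}"
    using ne sic i unfolding SIC_def by blast
  then obtain u v where uv: "u \<in> K" "v \<in> K" "z = f i v" "z = f j u"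
    by blast
  have crit: "z \<in> critical_set N f K"
    using z i unfolding critical_set_def by blast
  have P: "u \<in> P" "v \<in> P"
    using critical_imp_P[OF i(2)] critical_imp_P[OF i(1)] crit uv by auto
  have "(THE (u, v). u \<in> P \<and> v \<in> P \<and> f i v = f j u) = (u, v)"
  proof (rule the_equality)
    fix q assume "case q of (u, v) \<Rightarrow> u \<in> P \<and> v \<in> P \<and> f i v = f j u"
    then obtain u' v' where q: "q = (u', v')" "u' \<in> P" "v' \<in> P" "f i v' = f j u'"
      by (cases q) auto
    then have "f i v' \<in> f i ` K \<inter> f j ` K"
      using P_subset_K by (metis IntI image_eqI subsetD)
    then have "f i v' = f i v" "f j u' = f j u"
      using z q(4) uv by auto
    then show "q = (u, v)"
      using q(1) f_inj i by auto
  qed (use P uv in auto)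
  then show ?thesis
    using that[OF P] uv z ne i by auto
qed

text \<open>The hypothesis on the relabeling speaks only about states over \<open>P\<close>; this
  makes it applicable along every run.\<close>

lemma run_in_states:
  assumes "SIC N f K" "\<omega> \<in> inf_words N" "\<tau> \<in> inf_words N"
  shows "run f K P \<omega> \<tau> n \<in> automaton_states P"
proof (induction n)
  case (Suc n)
  have ij: "\<omega> n \<in> {1..N}" "\<tau> n \<in> {1..N}"
    using assms by (auto simp: inf_words_def)
  show ?case
  proof (cases "run f K P \<omega> \<tau> n")
    case Init
    show ?thesis
    proof (cases "\<omega> n = \<tau> n \<or> f (\<omega> n) ` K \<inter> f (\<tau> n) ` K = {}")
      case True
      then show ?thesis using Init by (auto simp: automaton_states_def)
    next
      case False
      then obtain u v where "u \<in> P" "v \<in> P" "automaton_trans f K P Init (\<omega> n, \<tau> n) = S u v"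
        using trans_Init[OF ij _ assms(1)] by metis
      then show ?thesis
        using Init by (simp add: automaton_states_def del: automaton_trans.simps)
    qed
  next
    case (S u v)
    then show ?thesis
      using trans_S_not_Exit[OF ij, of u v]
      by (cases "automaton_trans f K P (S u v) (\<omega> n, \<tau> n) = Exit")
        (auto simp: automaton_states_def simp del: automaton_trans.simps)
  qed (simp add: automaton_states_def)
qed (simp add: automaton_states_def)

text \<open>\<open>Init\<close> can be reached only from \<open>Init\<close>, and only by reading
  two equal letters.\<close>

lemma run_Init:
  assumes "\<omega> \<in> inf_words N" "\<tau> \<in> inf_words N" "SIC N f K"
    and "run f K P \<omega> \<tau> n = Init"
  shows "prefix \<omega> n = prefix \<tau> n"
  using assms(4)
proof (induction n)
  case (Suc n)
  have ij: "\<omega> n \<in> {1..N}" "\<tau> n \<in> {1..N}"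
    using assms by (auto simp: inf_words_def)
  show ?case
  proof (cases "run f K P \<omega> \<tau> n")
    case Init
    then have "\<omega> n = \<tau> n"
      using Suc.prems trans_Init[OF ij _ assms(3)] by (metis automaton_trans.simps(1) run.simps(2) state.distinct(1,3))
    then show ?thesis using Suc.IH Init by simp
  next
    case (S u v)
    then show ?thesis
      using Suc.prems trans_S_not_Exit[OF ij, of u v] unfolding run.simps
      by (metis state.distinct(1,3))
  qed (use Suc.prems in auto)
qed simp

text \<open>The invariant of a run: \<open>m\<close> is the index where the words split,
  \<open>z\<close> is the common point of the two pieces there, and \<open>v\<close> and
  \<open>u\<close> are the positions of this point inside the cylinders of \<omega> and \<tau> of
  level \<open>n\<close>. Both cylinders therefore contain the image of \<open>z\<close> under the
  common prefix.\<close>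

lemma run_S:
  assumes "\<omega> \<in> inf_words N" "\<tau> \<in> inf_words N" "SIC N f K"
    and "run f K P \<omega> \<tau> n = S u v"
  shows "u \<in> P \<and> v \<in> P \<and> (\<exists>m<n. \<exists>z. prefix \<omega> m = prefix \<tau> m \<and> \<omega> m \<noteq> \<tau> m \<and>
    f (\<omega> m) ` K \<inter> f (\<tau> m) ` K = {z} \<and>
    word_map f (prefix \<omega> m) z = word_map f (prefix \<omega> n) v \<and>
    word_map f (prefix \<tau> m) z = word_map f (prefix \<tau> n) u)"
  using assms(4)
proof (induction n arbitrary: u v)
  case (Suc n)
  have ij: "\<omega> n \<in> {1..N}" "\<tau> n \<in> {1..N}"
    using assms by (auto simp: inf_words_def)
  show ?case
  proof (cases "run f K P \<omega> \<tau> n")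
    case Init
    then have ne: "\<omega> n \<noteq> \<tau> n" "f (\<omega> n) ` K \<inter> f (\<tau> n) ` K \<noteq> {}"
      using Suc.prems by (auto split: if_splits)
    obtain u' v' where uv: "u' \<in> P" "v' \<in> P" "f (\<omega> n) v' = f (\<tau> n) u'"
        "f (\<omega> n) ` K \<inter> f (\<tau> n) ` K = {f (\<omega> n) v'}"
        "automaton_trans f K P Init (\<omega> n, \<tau> n) = S u' v'"
      using trans_Init[OF ij ne(1) assms(3) ne(2)] by blast
    then have "u' = u" "v' = v"
      using Suc.prems Init by auto
    \<comment> \<open>The words split at index \<open>n\<close> itself, so \<open>m = n\<close> and
      \<open>z\<close> is the point just found.\<close>
    then show ?thesis
      using uv ne(1) run_Init[OF assms(1-3) Init]
      by (intro conjI exI[of _ n] exI[of _ "f (\<omega> n) v"]) auto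
  next
    case (S u1 v1)
    have "automaton_trans f K P (S u1 v1) (\<omega> n, \<tau> n) = S u v"
      using S Suc.prems by (simp del: automaton_trans.simps)
    then obtain "u \<in> P" "v \<in> P" "f (\<omega> n) v = v1" "f (\<tau> n) u = u1"
      using trans_S_not_Exit[OF ij, of u1 v1] by (metis state.distinct(5) state.inject)
    \<comment> \<open>Only \<open>u\<close> and \<open>v\<close> are pulled back by one more letter;
      \<open>m\<close> and \<open>z\<close> stay the same.\<close>
    then show ?thesis
      using Suc.IH[OF S] by (auto intro: less_SucI)
  qed (use Suc.prems in auto)
qed simp

section \<open>Exit times against distances\<close>

lemma not_exit_upper_bound:
  assumes sic: "SIC N f K"
  obtains C r where "0 < C" "0 < r" "r < 1"
    "\<And>\<omega> \<tau> n. \<omega> \<in> inf_words N \<Longrightarrow> \<tau> \<in> inf_words N \<Longrightarrow> run f K P \<omega> \<tau> n \<noteq> Exit \<Longrightarrow>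
      dist (\<pi> \<omega>) (\<pi> \<tau>) \<le> C * r ^ n"
proof -
  obtain D r where D: "D > 0" and r: "0 < r" "r < 1" and cyl:
    "\<And>\<omega> n x y. \<omega> \<in> inf_words N \<Longrightarrow> x \<in> word_map f (prefix \<omega> n) ` K \<Longrightarrow>
      y \<in> word_map f (prefix \<omega> n) ` K \<Longrightarrow> dist x y \<le> D * r ^ n"
    using cylinder_diameter by blast
  show ?thesis
  proof (rule that[of "2 * D" r])
    fix \<omega> \<tau> n
    assume \<omega>: "\<omega> \<in> inf_words N" and \<tau>: "\<tau> \<in> inf_words N" and ne: "run f K P \<omega> \<tau> n \<noteq> Exit"
    \<comment> \<open>The two cylinders meet: in state \<open>Init\<close> they coincide, and in
      state \<open>S u v\<close> they share the point recorded by \<open>run_S\<close>. Passing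
      through that point accounts for the factor 2.\<close>
    have "\<exists>z. z \<in> word_map f (prefix \<omega> n) ` K \<and> z \<in> word_map f (prefix \<tau> n) ` K"
    proof (cases "run f K P \<omega> \<tau> n")
      case Init
      then show ?thesis
        using run_Init[OF \<omega> \<tau> sic] K_nonempty by (metis all_not_in_conv imageI)
    next
      case (S u v)
      then show ?thesis
        using run_S[OF \<omega> \<tau> sic S] P_subset_K by (metis imageI subsetD)
    qed (use ne in simp)
    then obtain z where "z \<in> word_map f (prefix \<omega> n) ` K" "z \<in> word_map f (prefix \<tau> n) ` K"
      by blast
    then have "dist (\<pi> \<omega>) z \<le> D * r ^ n" "dist (\<pi> \<tau>) z \<le> D * r ^ n"
      using cyl coding_map_in_cylinder \<omega> \<tau> by blast+
    then show "dist (\<pi> \<omega>) (\<pi> \<tau>) \<le> 2 * D * r ^ n"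
      using dist_triangle2[of "\<pi> \<omega>" "\<pi> \<tau>" z] by linarith
  qed (use D r in auto)
qed

lemma disjoint_pieces_separated:
  "\<exists>d>0. \<forall>i\<in>{1..N}. \<forall>j\<in>{1..N}. f i ` K \<inter> f j ` K = {} \<longrightarrow>
     (\<forall>x\<in>f i ` K. \<forall>y\<in>f j ` K. d \<le> dist x y)"
proof -
  have "\<exists>d>0. \<forall>ij\<in>{1..N} \<times> {1..N}. f (fst ij) ` K \<inter> f (snd ij) ` K = {} \<longrightarrow>
     (\<forall>x\<in>f (fst ij) ` K. \<forall>y\<in>f (snd ij) ` K. d \<le> dist x y)"
  proof (rule finite_uniform_pos)
    fix ij assume "ij \<in> {1..N} \<times> {1..N}"
    then have c: "compact (f (fst ij) ` K)" "closed (f (snd ij) ` K)"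
      using compact_image compact_imp_closed by (auto simp: mem_Times_iff)
    show "\<exists>d>0. f (fst ij) ` K \<inter> f (snd ij) ` K = {} \<longrightarrow>
     (\<forall>x\<in>f (fst ij) ` K. \<forall>y\<in>f (snd ij) ` K. d \<le> dist x y)"
      using separate_compact_closed_metric[OF c] zero_less_one by metis
  next
    fix ij and d e :: real
    assume "f (fst ij) ` K \<inter> f (snd ij) ` K = {} \<longrightarrow>
      (\<forall>x\<in>f (fst ij) ` K. \<forall>y\<in>f (snd ij) ` K. d \<le> dist x y)" "e \<le> d"
    then show "f (fst ij) ` K \<inter> f (snd ij) ` K = {} \<longrightarrow>
      (\<forall>x\<in>f (fst ij) ` K. \<forall>y\<in>f (snd ij) ` K. e \<le> dist x y)"
      by (meson order_trans)
  qed simp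
  then show ?thesis by simp
qed

text \<open>Each point outside a compact piece has positive distance from it. Post-critical
  finiteness leaves finitely many pairs of a point and a piece, hence one bound for all.\<close>

lemma post_critical_points_separated:
  assumes "pcf N f K"
  shows "\<exists>d>0. \<forall>v\<in>P. \<forall>i\<in>{1..N}. v \<notin> f i ` K \<longrightarrow> (\<forall>x\<in>f i ` K. d \<le> dist x v)"
proof -
  have "\<exists>d>0. \<forall>vi\<in>P \<times> {1..N}. fst vi \<notin> f (snd vi) ` K \<longrightarrow>
     (\<forall>x\<in>f (snd vi) ` K. d \<le> dist x (fst vi))"
  proof (rule finite_uniform_pos)
    show "finite (P \<times> {1..N})"
      using pcf_imp_finite[OF assms] by simp
    fix vi assume "vi \<in> P \<times> {1..N}"
    then have c: "compact (f (snd vi) ` K)"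
      using compact_image by (auto simp: mem_Times_iff)
    then show "\<exists>d>0. fst vi \<notin> f (snd vi) ` K \<longrightarrow> (\<forall>x\<in>f (snd vi) ` K. d \<le> dist x (fst vi))"
      using separate_compact_closed_metric[OF c closed_singleton, of "fst vi"]
      by (cases "fst vi \<in> f (snd vi) ` K") (auto intro: gt_ex)
  next
    fix vi and d e :: real
    assume "fst vi \<notin> f (snd vi) ` K \<longrightarrow> (\<forall>x\<in>f (snd vi) ` K. d \<le> dist x (fst vi))" "e \<le> d"
    then show "fst vi \<notin> f (snd vi) ` K \<longrightarrow> (\<forall>x\<in>f (snd vi) ` K. e \<le> dist x (fst vi))"
      by (meson order_trans)
  qed
  then show ?thesis by simp
qed

lemma exit_lower_bound:
  assumes pcf: "pcf N f K" and sic: "SIC N f K" and asc: "ASC N f K"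
  obtains c a where "0 < c" "0 < a" "a < 1"
    "\<And>\<omega> \<tau> n. \<omega> \<in> inf_words N \<Longrightarrow> \<tau> \<in> inf_words N \<Longrightarrow> run f K P \<omega> \<tau> n = Exit \<Longrightarrow>
      c * a ^ n \<le> dist (\<pi> \<omega>) (\<pi> \<tau>)"
proof -
  obtain a r where a: "0 < a" "a < 1" "0 < r" "r < 1"
    "\<And>i x y. i \<in> {1..N} \<Longrightarrow> a * dist x y \<le> dist (f i x) (f i y)"
    "\<And>i x y. i \<in> {1..N} \<Longrightarrow> dist (f i x) (f i y) \<le> r * dist x y"
    using ratio_bounds by metis
  obtain d1 where d1: "d1 > 0" "\<And>i j x y. \<lbrakk>i \<in> {1..N}; j \<in> {1..N}; f i ` K \<inter> f j ` K = {};
      x \<in> f i ` K; y \<in> f j ` K\<rbrakk> \<Longrightarrow> d1 \<le> dist x y"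
    using disjoint_pieces_separated by metis
  obtain d2 where d2: "d2 > 0" "\<And>v i x. \<lbrakk>v \<in> P; i \<in> {1..N}; v \<notin> f i ` K; x \<in> f i ` K\<rbrakk>
      \<Longrightarrow> d2 \<le> dist x v"
    using post_critical_points_separated[OF pcf] by metis
  obtain c where c: "c > 0" "\<And>i j z x y. \<lbrakk>i \<in> {1..N}; j \<in> {1..N}; i \<noteq> j;
      f i ` K \<inter> f j ` K = {z}; x \<in> f i ` K; y \<in> f j ` K\<rbrakk>
      \<Longrightarrow> c * max (dist x z) (dist y z) \<le> dist x y"
    using asc unfolding ASC_def by metis
  have low: "a ^ n * dist x y \<le> dist (word_map f (prefix \<omega> n) x) (word_map f (prefix \<omega> n) y)"
    if "\<omega> \<in> inf_words N" for \<omega> n x y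
    using word_map_lower[OF a(5,1) set_prefix[OF that], of n x y] by simp
  have contr: "dist (word_map f (prefix \<omega> n) x) (word_map f (prefix \<omega> n) y) \<le> dist x y"
    if "\<omega> \<in> inf_words N" for \<omega> n x y
  proof -
    have "r ^ n * dist x y \<le> 1 * dist x y"
      using a by (intro mult_right_mono power_le_one) auto
    then show ?thesis
      using word_map_upper[OF a(6,3) set_prefix[OF that], of n x y] by simp
  qed
  have piece: "\<exists>x\<in>f (\<omega> n) ` K. \<pi> \<omega> = word_map f (prefix \<omega> n) x"
    if "\<omega> \<in> inf_words N" for \<omega> n
    using coding_map_in_cylinder[OF that, of "Suc n"] by auto
  \<comment> \<open>\<open>d1\<close> serves exits from \<open>Init\<close>, where two pieces are
    disjoint; \<open>c * d2\<close> serves exits from a state \<open>S u v\<close>, where the ASC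
    costs the factor \<open>c\<close>.\<close>
  define b where "b = min d1 (c * d2)"
  have b: "b > 0" using d1 c d2 by (simp add: b_def)
  \<comment> \<open>This treats the first exit. The square of \<open>a\<close> appears because an
    exit from \<open>S u v\<close> loses a power of \<open>a\<close> twice: once in measuring the
    distance to the common point, once in mapping back along the common prefix.\<close>
  have main: "b * (a\<^sup>2) ^ n \<le> dist (\<pi> \<omega>) (\<pi> \<tau>)"
    if \<omega>: "\<omega> \<in> inf_words N" and \<tau>: "\<tau> \<in> inf_words N"
      and ne: "run f K P \<omega> \<tau> n \<noteq> Exit" and ex: "run f K P \<omega> \<tau> (Suc n) = Exit" for \<omega> \<tau> n
  proof -
    have ij: "\<omega> k \<in> {1..N}" "\<tau> k \<in> {1..N}" for k
      using \<omega> \<tau> by (auto simp: inf_words_def)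
    obtain x where x: "x \<in> f (\<omega> n) ` K" "\<pi> \<omega> = word_map f (prefix \<omega> n) x"
      using piece \<omega> by blast
    obtain y where y: "y \<in> f (\<tau> n) ` K" "\<pi> \<tau> = word_map f (prefix \<tau> n) y"
      using piece \<tau> by blast
    have an: "(a\<^sup>2) ^ n = a ^ n * a ^ n"
      by (simp add: power2_eq_square power_mult_distrib)
    show ?thesis
    proof (cases "run f K P \<omega> \<tau> n")
      case Init
      then have "f (\<omega> n) ` K \<inter> f (\<tau> n) ` K = {}"
        using ex trans_Init[OF ij[of n] _ sic]
        by (metis automaton_trans.simps(1) run.simps(2) state.distinct(1,5))
      then have "d1 \<le> dist x y"
        using d1(2) ij x y by blast
      have "b * (a\<^sup>2) ^ n \<le> a ^ n * d1"
      proof -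
        have "a ^ n * a ^ n \<le> a ^ n * 1"
          using a by (intro mult_left_mono power_le_one) auto
        then have "b * (a ^ n * a ^ n) \<le> d1 * a ^ n"
          using b a by (intro mult_mono) (auto simp: b_def)
        then show ?thesis by (simp add: an mult.commute)
      qed
      also have "\<dots> \<le> a ^ n * dist x y"
        using \<open>d1 \<le> dist x y\<close> a by (intro mult_left_mono) auto
      also have "\<dots> \<le> dist (\<pi> \<omega>) (\<pi> \<tau>)"
        using low[OF \<omega>] x y run_Init[OF \<omega> \<tau> sic Init] by metis
      finally show ?thesis .
    next
      case (S u v)
      obtain m z where P: "u \<in> P" "v \<in> P"
        and m: "m < n" "prefix \<omega> m = prefix \<tau> m" "\<omega> m \<noteq> \<tau> m"
        and z: "f (\<omega> m) ` K \<inter> f (\<tau> m) ` K = {z}"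
          "word_map f (prefix \<omega> m) z = word_map f (prefix \<omega> n) v"
          "word_map f (prefix \<tau> m) z = word_map f (prefix \<tau> n) u"
        using run_S[OF \<omega> \<tau> sic S] by blast
      \<comment> \<open>\<open>x\<close> and \<open>y\<close> sit at the exit level
        \<open>n\<close>; \<open>x'\<close> and \<open>y'\<close> represent the same coded points at
        the splitting level \<open>m\<close>, where the ASC applies.\<close>
      obtain x' where x': "x' \<in> f (\<omega> m) ` K" "\<pi> \<omega> = word_map f (prefix \<omega> m) x'"
        using piece \<omega> by blast
      obtain y' where y': "y' \<in> f (\<tau> m) ` K" "\<pi> \<tau> = word_map f (prefix \<tau> m) y'"
        using piece \<tau> by blast
      have "v \<notin> f (\<omega> n) ` K \<or> u \<notin> f (\<tau> n) ` K"
        using trans_S_Exit[OF ij P] ex S by (metis run.simps(2))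
      then have "d2 \<le> dist x v \<or> d2 \<le> dist y u"
        using d2(2) P ij x y by blast
      then have "a ^ n * d2 \<le> a ^ n * dist x v \<or> a ^ n * d2 \<le> a ^ n * dist y u"
        using a by auto
      \<comment> \<open>The coded point and the common point are the images of \<open>x\<close>,
        \<open>v\<close> under the prefix of length \<open>n\<close> and of \<open>x'\<close>,
        \<open>z\<close> under the prefix of length \<open>m\<close>. The first view bounds their
        distance from below, the second from above.\<close>
      moreover have "a ^ n * dist x v \<le> dist x' z"
        using low[OF \<omega>, of n x v] contr[OF \<omega>, of m x' z] x x' z by simp
      moreover have "a ^ n * dist y u \<le> dist y' z"
        using low[OF \<tau>, of n y u] contr[OF \<tau>, of m y' z] y y' z by simp
      ultimately have max: "a ^ n * d2 \<le> max (dist x' z) (dist y' z)"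
        by linarith
      have "b * (a\<^sup>2) ^ n \<le> (c * d2) * (a ^ n * a ^ n)"
        using a unfolding an b_def by (intro mult_right_mono) auto
      also have "\<dots> = a ^ n * (c * (a ^ n * d2))"
        by simp
      also have "\<dots> \<le> a ^ n * (c * max (dist x' z) (dist y' z))"
        using a c max by (intro mult_left_mono) auto
      also have "\<dots> \<le> a ^ n * dist x' y'"
        using a c(2)[OF ij m(3) z(1) x'(1) y'(1)] by (intro mult_left_mono) auto
      \<comment> \<open>The common prefix has length only \<open>m < n\<close>, so mapping back
        costs at most the second factor \<open>a ^ n\<close>.\<close>
      also have "\<dots> \<le> a ^ m * dist x' y'"
        using a m(1) by (intro mult_right_mono power_decreasing) auto
      also have "\<dots> \<le> dist (\<pi> \<omega>) (\<pi> \<tau>)"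
        using low[OF \<omega>, of m x' y'] x' y' m(2) by simp
      finally show ?thesis .
    qed (use ne in simp)
  qed
  show ?thesis
  proof (rule that[of b "a\<^sup>2"])
    fix \<omega> \<tau> n
    assume \<omega>: "\<omega> \<in> inf_words N" and \<tau>: "\<tau> \<in> inf_words N" and "run f K P \<omega> \<tau> n = Exit"
    then show "b * (a\<^sup>2) ^ n \<le> dist (\<pi> \<omega>) (\<pi> \<tau>)"
    \<comment> \<open>The induction descends to the first exit, since a larger \<open>n\<close> only
      weakens the bound. A run starts in \<open>Init\<close>, so there is no exit at 0.\<close>
    proof (induction n)
      case (Suc n)
      have "(a\<^sup>2) ^ Suc n \<le> (a\<^sup>2) ^ n"
        using a by (intro power_decreasing) (auto simp: power_le_one)
      then have "b * (a\<^sup>2) ^ Suc n \<le> b * (a\<^sup>2) ^ n"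
        using b by (intro mult_left_mono) auto
      also have "\<dots> \<le> dist (\<pi> \<omega>) (\<pi> \<tau>)"
        using Suc main by blast
      finally show ?case .
    qed simp
  qed (use a b in \<open>auto simp: power_less_one_iff\<close>)
qed

end

section \<open>From exit times to Hoelder estimates\<close>

lemma le_powr_of_exit_bounds:
  fixes E :: "nat \<Rightarrow> bool" and d1 d2 :: real
  assumes "\<not> E 0" and upper: "\<And>n. \<not> E n \<Longrightarrow> d2 \<le> C * r ^ n"
    and lower: "\<And>n. E n \<Longrightarrow> c * a ^ n \<le> d1"
    and C: "0 < C" and r: "0 < r" "r < 1" and c: "0 < c" and a: "0 < a" "a < 1"
    and s: "0 < s" "s \<le> ln r / ln a"
  shows "d2 \<le> C * (1 / (c * a)) powr s * d1 powr s"
proof (cases "\<exists>n. E n")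
  case False
  \<comment> \<open>Without an exit the upper bound holds for all \<open>n\<close> and tends to
    0.\<close>
  then have "d2 \<le> 0"
    using le_geometric_imp_le_0 upper r by metis
  then show ?thesis
    using C by (smt (verit) mult_nonneg_nonneg powr_ge_zero)
next
  case True
  \<comment> \<open>At the first exit both bounds are available, the upper one at \<open>n\<close>
    and the lower one at \<open>Suc n\<close>; this shift is the source of the factor
    \<open>1 / a\<close>.\<close>
  then obtain n where n: "\<not> E n" "E (Suc n)"
    using \<open>\<not> E 0\<close> nat_induct[of "\<lambda>n. \<not> E n"] by blast
  \<comment> \<open>Since \<open>ln a\<close> is negative, the bound on \<open>s\<close> says
    exactly that \<open>r\<close> is at most \<open>a powr s\<close>, which converts one geometric
    rate into the other.\<close>
  have "ln r \<le> s * ln a"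
    using s a by (simp add: neg_le_divide_eq)
  then have "r \<le> a powr s"
    using r a by (metis exp_le_cancel_iff exp_ln powr_def less_irrefl)
  then have "r ^ n \<le> (a powr s) ^ n"
    using r by (intro power_mono) auto
  also have "\<dots> = (a ^ n) powr s"
    using a by (simp add: powr_power powr_realpow[symmetric] powr_powr mult.commute)
  also have "\<dots> \<le> (1 / (c * a) * d1) powr s"
    using lower[OF n(2)] a c s by (intro powr_mono2) (auto simp: field_simps)
  also have "\<dots> = (1 / (c * a)) powr s * d1 powr s"
    by (rule powr_mult)
  finally have "C * r ^ n \<le> C * ((1 / (c * a)) powr s * d1 powr s)"
    using C by (intro mult_left_mono) auto
  then show ?thesis
    using upper[OF n(1)] by (simp add: mult.assoc)
qed

text \<open>Both sets are compared through a common parametrization. As \<open>0 powr s = 0\<close>,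
  the two estimates force \<open>p\<close> and \<open>q\<close> to identify the same parameters, so
  \<open>q\<close> factors through \<open>p\<close> by a bijection.\<close>

lemma Holder_equivalentI:
  fixes p :: "'w \<Rightarrow> 'a::metric_space" and q :: "'w \<Rightarrow> 'b::metric_space"
  assumes p: "p ` W = K" and q: "q ` W = K'" and "0 < A" "0 < B" "0 < s"
    and qp: "\<And>u v. u \<in> W \<Longrightarrow> v \<in> W \<Longrightarrow> dist (q u) (q v) \<le> A * dist (p u) (p v) powr s"
    and pq: "\<And>u v. u \<in> W \<Longrightarrow> v \<in> W \<Longrightarrow> dist (p u) (p v) \<le> B * dist (q u) (q v) powr s"
  shows "Holder_equivalent K K'"
proof -
  have eq: "p u = p v \<longleftrightarrow> q u = q v" if "u \<in> W" "v \<in> W" for u v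
    using qp[OF that] pq[OF that] by auto
  define h where "h x = q (inv_into W p x)" for x
  have h: "h (p u) = q u" if "u \<in> W" for u
  proof -
    have "inv_into W p (p u) \<in> W" "p (inv_into W p (p u)) = p u"
      using that by (auto intro: inv_into_into f_inv_into_f)
    then show ?thesis
      using eq[OF _ that] unfolding h_def by blast
  qed
  \<comment> \<open>Raising the estimate \<open>pq\<close> to the power \<open>1 / s\<close> gives
    the lower Hoelder bound with constant \<open>B powr (1 / s)\<close>; the maximum serves both
    bounds.\<close>
  define C where "C = max A (B powr (1 / s))"
  have "bij_betw h K K'"
  proof (rule bij_betw_imageI)
    show "inj_on h K"
      using h eq p by (auto simp: inj_on_def)
    show "h ` K = K'"
      unfolding p[symmetric] q[symmetric] image_image using h by simp
  qed
  moreover have "inverse C * dist x y powr (1 / s) \<le> dist (h x) (h y) \<and>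
      dist (h x) (h y) \<le> C * dist x y powr s" if xy: "x \<in> K" "y \<in> K" for x y
  proof
    obtain u v where uv: "u \<in> W" "v \<in> W" "x = p u" "y = p v"
      using xy p by blast
    have C: "A \<le> C" "B powr (1 / s) \<le> C" "C > 0"
      using \<open>0 < A\<close> by (auto simp: C_def)
    have "dist (h x) (h y) \<le> A * dist x y powr s"
      using qp uv h by simp
    also have "\<dots> \<le> C * dist x y powr s"
      using C by (intro mult_right_mono) auto
    finally show "dist (h x) (h y) \<le> C * dist x y powr s" .
    have "dist x y powr (1 / s) \<le> (B * dist (h x) (h y) powr s) powr (1 / s)"
      using pq uv h \<open>0 < s\<close> by (intro powr_mono2) auto
    also have "\<dots> = B powr (1 / s) * dist (h x) (h y)"
      using \<open>0 < s\<close> \<open>0 < B\<close> by (simp add: powr_mult powr_powr)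
    also have "\<dots> \<le> C * dist (h x) (h y)"
      using C by (intro mult_right_mono) auto
    finally show "inverse C * dist x y powr (1 / s) \<le> dist (h x) (h y)"
      using C by (simp add: field_simps)
  qed
  moreover have "C > 0"
    using \<open>0 < A\<close> by (simp add: C_def)
  ultimately show ?thesis
    unfolding Holder_equivalent_def using \<open>0 < s\<close> by blast
qed

theorem theorem1p1:
  fixes f :: "nat \<Rightarrow> 'a::complete_space \<Rightarrow> 'a" and g :: "nat \<Rightarrow> 'b::complete_space \<Rightarrow> 'b"
    and N :: nat and K :: "'a set" and K' :: "'b set"
  assumes "IFS N f" and "IFS N g"
    and "is_attractor N f K" and "is_attractor N g K'"
    and "pcf N f K" and "pcf N g K'"
    and "SIC N f K" and "SIC N g K'"
    and "ASC N f K" and "ASC N g K'"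
    and "same_topology_automaton N f K g K'"
  shows "Holder_equivalent K K'"
proof -
  interpret F: attractor_IFS N f K
    using assms by unfold_locales
  interpret G: attractor_IFS N g K'
    using assms by unfold_locales
  obtain \<beta> where \<beta>: "\<And>q a. q \<in> automaton_states F.P \<Longrightarrow> a \<in> {1..N} \<times> {1..N} \<Longrightarrow>
      automaton_trans g K' G.P (map_state \<beta> q) a = map_state \<beta> (automaton_trans f K F.P q a)"
    using assms(11) unfolding same_topology_automaton_def Let_def by blast
  have run: "run g K' G.P \<omega> \<tau> n = map_state \<beta> (run f K F.P \<omega> \<tau> n)"
    if "\<omega> \<in> inf_words N" "\<tau> \<in> inf_words N" for \<omega> \<tau> n
  proof (induction n)
    case (Suc n)
    have "(\<omega> n, \<tau> n) \<in> {1..N} \<times> {1..N}"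
      using that by (simp add: inf_words_def)
    then show ?case
      using \<beta>[OF F.run_in_states[OF assms(7) that]] Suc by (simp del: automaton_trans.simps)
  qed simp
  \<comment> \<open>A relabeling fixes \<open>Exit\<close> and sends no other state to it, so both
    automata exit at the same time.\<close>
  have exit: "run g K' G.P \<omega> \<tau> n = Exit \<longleftrightarrow> run f K F.P \<omega> \<tau> n = Exit"
    if "\<omega> \<in> inf_words N" "\<tau> \<in> inf_words N" for \<omega> \<tau> n
    unfolding run[OF that] by (cases "run f K F.P \<omega> \<tau> n") auto
  obtain C1 r1 where U1: "0 < C1" "0 < r1" "r1 < 1"
    "\<And>\<omega> \<tau> n. \<omega> \<in> inf_words N \<Longrightarrow> \<tau> \<in> inf_words N \<Longrightarrow> run f K F.P \<omega> \<tau> n \<noteq> Exit \<Longrightarrow>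
      dist (F.\<pi> \<omega>) (F.\<pi> \<tau>) \<le> C1 * r1 ^ n"
    using F.not_exit_upper_bound[OF assms(7)] by blast
  obtain c1 a1 where L1: "0 < c1" "0 < a1" "a1 < 1"
    "\<And>\<omega> \<tau> n. \<omega> \<in> inf_words N \<Longrightarrow> \<tau> \<in> inf_words N \<Longrightarrow> run f K F.P \<omega> \<tau> n = Exit \<Longrightarrow>
      c1 * a1 ^ n \<le> dist (F.\<pi> \<omega>) (F.\<pi> \<tau>)"
    using F.exit_lower_bound[OF assms(5,7,9)] by blast
  obtain C2 r2 where U2: "0 < C2" "0 < r2" "r2 < 1"
    "\<And>\<omega> \<tau> n. \<omega> \<in> inf_words N \<Longrightarrow> \<tau> \<in> inf_words N \<Longrightarrow> run g K' G.P \<omega> \<tau> n \<noteq> Exit \<Longrightarrow>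
      dist (G.\<pi> \<omega>) (G.\<pi> \<tau>) \<le> C2 * r2 ^ n"
    using G.not_exit_upper_bound[OF assms(8)] by blast
  obtain c2 a2 where L2: "0 < c2" "0 < a2" "a2 < 1"
    "\<And>\<omega> \<tau> n. \<omega> \<in> inf_words N \<Longrightarrow> \<tau> \<in> inf_words N \<Longrightarrow> run g K' G.P \<omega> \<tau> n = Exit \<Longrightarrow>
      c2 * a2 ^ n \<le> dist (G.\<pi> \<omega>) (G.\<pi> \<tau>)"
    using G.exit_lower_bound[OF assms(6,8,10)] by blast
  \<comment> \<open>Each direction pairs the upper rate of one attractor with the lower rate of the
    other; the minimum is admissible for both, and it is positive because all the logarithms are
    negative.\<close>
  define s where "s = min (ln r2 / ln a1) (ln r1 / ln a2)"
  have s: "s > 0" "s \<le> ln r2 / ln a1" "s \<le> ln r1 / ln a2"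
    using U1 U2 L1 L2 by (auto simp: s_def divide_neg_neg)
  show ?thesis
  proof (rule Holder_equivalentI)
    show "F.\<pi> ` inf_words N = K"
      using F.coding_map_in_K F.coding_map_surj by (metis image_subset_iff imageI subsetI subset_antisym)
    show "G.\<pi> ` inf_words N = K'"
      using G.coding_map_in_K G.coding_map_surj by (metis image_subset_iff imageI subsetI subset_antisym)
    fix \<omega> \<tau> assume \<omega>\<tau>: "\<omega> \<in> inf_words N" "\<tau> \<in> inf_words N"
    show "dist (G.\<pi> \<omega>) (G.\<pi> \<tau>) \<le> C2 * (1 / (c1 * a1)) powr s * dist (F.\<pi> \<omega>) (F.\<pi> \<tau>) powr s"
      by (rule le_powr_of_exit_bounds[where E = "\<lambda>n. run f K F.P \<omega> \<tau> n = Exit" and r = r2])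
        (use U2 L1 s exit \<omega>\<tau> in auto)
    show "dist (F.\<pi> \<omega>) (F.\<pi> \<tau>) \<le> C1 * (1 / (c2 * a2)) powr s * dist (G.\<pi> \<omega>) (G.\<pi> \<tau>) powr s"
      by (rule le_powr_of_exit_bounds[where E = "\<lambda>n. run f K F.P \<omega> \<tau> n = Exit" and r = r1])
        (use U1 L2 s exit \<omega>\<tau> in auto)
  qed (use U1 U2 L1 L2 s in auto)
qed

end
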